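(* Let $(A,\cdot,\circ)$ be a skew brace. Then setting $A_0=A$ and $A_i=L^i(A)$ for $i\ge1$ makes $(A,\cdot,\circ)$ into a filtered skew brace.
   Context: A skew brace $(A,\cdot,\circ)$ is a set $A$ with two group structures such that $a\circ(b\cdot c)=(a\circ b)\cdot a^{-1}\cdot(a\circ c)$ for all $a,b,c$, where $a^{-1}$ is the inverse in $(A,\cdot)$. Put $\lambda_a(b)=a^{-1}\cdot(a\circ b)$ and $a*b=a^{-1}\cdot(a\circ b)\cdot b^{-1}$. Define $L^1(A)=A$ and let $L^{i+1}(A)$ be the subgroup of $(A,\cdot)$ generated by all $a*b$ and $a\cdot b\cdot a^{-1}\cdot b^{-1}$ with $a\in A$, $b\in L^i(A)$. A strong left ideal of $A$ is a normal subgroup $I$ of $(A,\cdot)$ with $\lambda_a(b)\in I$ for all $a\in A$, $b\in I$. A filtered skew brace is a skew brace with a descending chain $A=A_0\supseteq A_1\supseteq\cdots$ of strong left ideals such that $[A_i,A_j]\subseteq A_{i+j}$ for all $i,j$, commutators being taken in $(A,\cdot)$. *)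

theory Defs
  imports "HOL-Algebra.Generated_Groups"
begin

text \<open>The two group structures are two group records with a common carrier: the record M is
  \<open>(A, \<cdot>)\<close> and the record C is \<open>(A, \<circ>)\<close>.\<close>

locale skew_brace = M: group M + C: group C
  for M :: "'a monoid" (structure) and C :: "'a monoid" +
  assumes same_carrier: "carrier C = carrier M"
    and compat: "\<lbrakk>a \<in> carrier M; b \<in> carrier M; c \<in> carrier M\<rbrakk> \<Longrightarrow>
      a \<otimes>\<^bsub>C\<^esub> (b \<otimes>\<^bsub>M\<^esub> c) = (a \<otimes>\<^bsub>C\<^esub> b) \<otimes>\<^bsub>M\<^esub> inv\<^bsub>M\<^esub> a \<otimes>\<^bsub>M\<^esub> (a \<otimes>\<^bsub>C\<^esub> c)"

definition brace_lambda :: "'a monoid \<Rightarrow> 'a monoid \<Rightarrow> 'a \<Rightarrow> 'a \<Rightarrow> 'a" where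
  "brace_lambda M C a b = inv\<^bsub>M\<^esub> a \<otimes>\<^bsub>M\<^esub> (a \<otimes>\<^bsub>C\<^esub> b)"

definition brace_star :: "'a monoid \<Rightarrow> 'a monoid \<Rightarrow> 'a \<Rightarrow> 'a \<Rightarrow> 'a" where
  "brace_star M C a b = inv\<^bsub>M\<^esub> a \<otimes>\<^bsub>M\<^esub> (a \<otimes>\<^bsub>C\<^esub> b) \<otimes>\<^bsub>M\<^esub> inv\<^bsub>M\<^esub> b"

definition group_commutator :: "'a monoid \<Rightarrow> 'a \<Rightarrow> 'a \<Rightarrow> 'a" where
  "group_commutator M a b = a \<otimes>\<^bsub>M\<^esub> b \<otimes>\<^bsub>M\<^esub> inv\<^bsub>M\<^esub> a \<otimes>\<^bsub>M\<^esub> inv\<^bsub>M\<^esub> b"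

definition commutator_subgroup :: "'a monoid \<Rightarrow> 'a set \<Rightarrow> 'a set \<Rightarrow> 'a set" where
  "commutator_subgroup M H K = generate M {group_commutator M h k | h k. h \<in> H \<and> k \<in> K}"

text \<open>The series \<open>L\<^sup>i(A)\<close> starts at \<open>i = 1\<close>; the value at index 0 is a dummy.\<close>

fun L_series :: "'a monoid \<Rightarrow> 'a monoid \<Rightarrow> nat \<Rightarrow> 'a set" where
  "L_series M C 0 = carrier M"
| "L_series M C (Suc 0) = carrier M"
| "L_series M C (Suc (Suc i)) = generate M
     ({brace_star M C a b | a b. a \<in> carrier M \<and> b \<in> L_series M C (Suc i)} \<union>
      {group_commutator M a b | a b. a \<in> carrier M \<and> b \<in> L_series M C (Suc i)})"

definition strong_left_ideal :: "'a monoid \<Rightarrow> 'a monoid \<Rightarrow> 'a set \<Rightarrow> bool" where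
  "strong_left_ideal M C I \<longleftrightarrow>
     I \<lhd> M \<and> (\<forall>a\<in>carrier M. \<forall>b\<in>I. brace_lambda M C a b \<in> I)"

locale filtered_skew_brace = skew_brace M C
  for M :: "'a monoid" (structure) and C :: "'a monoid" and F :: "nat \<Rightarrow> 'a set" +
  assumes filtration_zero: "F 0 = carrier M"
    and filtration_descending: "F (Suc i) \<subseteq> F i"
    and filtration_ideal: "strong_left_ideal M C (F i)"
    and filtration_commutator: "commutator_subgroup M (F i) (F j) \<subseteq> F (i + j)"

end

theory Submission
  imports Defs
begin

text \<open>The two kinds of generators of \<open>L\<^sup>i\<^sup>+\<^sup>1(A)\<close> have one shape. The map \<open>\<lambda>\<^sub>a\<close> is an endomorphism of
  \<open>(A, \<cdot>)\<close>, and so is conjugation by \<open>a\<close>; if \<open>\<phi>\<close> is the first, then \<open>\<phi>(b) \<cdot> b\<^sup>-\<^sup>1 = a * b\<close>, and if it is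
  the second, then \<open>\<phi>(b) \<cdot> b\<^sup>-\<^sup>1 = [a, b]\<close>. So \<open>L\<^sup>i\<^sup>+\<^sup>1(A)\<close> is generated by the displacements
  \<open>\<phi>(b) \<cdot> b\<^sup>-\<^sup>1\<close> of the elements of \<open>L\<^sup>i(A)\<close> under these maps.

  The series is descending because \<open>A \<supseteq> L\<^sup>2(A)\<close> and the generators of one term depend monotonically on
  the term before. For \<open>b\<close> in \<open>L\<^sup>i(A)\<close> the element \<open>\<phi>(b) = (\<phi>(b) \<cdot> b\<^sup>-\<^sup>1) \<cdot> b\<close> then lies in \<open>L\<^sup>i(A)\<close> again,
  which for conjugations is normality and for the maps \<open>\<lambda>\<^sub>a\<close> is the strong left ideal condition.

  The inclusion \<open>[L\<^sup>i, L\<^sup>j] \<subseteq> L\<^sup>i\<^sup>+\<^sup>j\<close> goes by induction on \<open>i\<close>, for all \<open>j\<close> at once. It is an instance of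
  the three subgroups argument, carried out modulo \<open>N = L\<^sup>i\<^sup>+\<^sup>j\<^sup>+\<^sup>1\<close>: for \<open>b\<close> in \<open>L\<^sup>i\<close>, \<open>c\<close> in \<open>L\<^sup>j\<close> the commutator
  \<open>[b, c]\<close> is in \<open>L\<^sup>i\<^sup>+\<^sup>j\<close>, hence central and fixed by \<open>\<phi>\<close> modulo \<open>N\<close>, while \<open>\<phi>(c) \<cdot> c\<^sup>-\<^sup>1\<close> is in \<open>L\<^sup>j\<^sup>+\<^sup>1\<close>,
  hence commutes with \<open>\<phi>(b)\<close> modulo \<open>N\<close>. Thus \<open>[b, c] \<equiv> [\<phi>(b), \<phi>(c)] \<equiv> [\<phi>(b), c]\<close>, which makes
  \<open>\<phi>(b) \<cdot> b\<^sup>-\<^sup>1\<close> commute with \<open>c\<close> modulo \<open>N\<close> (\<open>commutator_displacement_in\<close>). The elements that commute with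
  \<open>c\<close> modulo \<open>N\<close> form a subgroup, so they contain \<open>L\<^sup>i\<^sup>+\<^sup>1\<close> as soon as they contain its generators
  (\<open>commutator_generate_in\<close>).\<close>

section \<open>Commutators in groups\<close>

context
  fixes G :: "'a monoid" (structure)
  assumes G: "group G"
begin

interpretation group G by (rule G)

lemma group_commutator_closed [simp]:
  "x \<in> carrier G \<Longrightarrow> y \<in> carrier G \<Longrightarrow> group_commutator G x y \<in> carrier G"
  by (simp add: group_commutator_def)

lemma group_commutator_mult_swap:
  assumes "x \<in> carrier G" "y \<in> carrier G"
  shows "group_commutator G x y \<otimes> (y \<otimes> x) = x \<otimes> y"
  using assms by (simp add: group_commutator_def m_assoc inv_solve_left')

lemma group_commutator_eqI:
  assumes "x \<in> carrier G" "y \<in> carrier G" "z \<in> carrier G" "x \<otimes> y = z \<otimes> (y \<otimes> x)"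
  shows "group_commutator G x y = z"
  using assms group_commutator_mult_swap[of x y] by (metis group_commutator_closed m_closed right_cancel)

lemma group_commutator_eq_one_iff:
  assumes "x \<in> carrier G" "y \<in> carrier G"
  shows "group_commutator G x y = \<one> \<longleftrightarrow> x \<otimes> y = y \<otimes> x"
  using assms group_commutator_mult_swap[of x y] group_commutator_eqI[of x y \<one>] by auto

lemma commuting_subgroup:
  assumes "c \<in> carrier G"
  shows "subgroup {x \<in> carrier G. x \<otimes> c = c \<otimes> x} G"
proof (rule subgroupI)
  fix x y assume xy: "x \<in> {x \<in> carrier G. x \<otimes> c = c \<otimes> x}" "y \<in> {x \<in> carrier G. x \<otimes> c = c \<otimes> x}"
  show "inv x \<in> {x \<in> carrier G. x \<otimes> c = c \<otimes> x}"
    using xy assms by simp (metis inv_closed inv_solve_left inv_solve_right m_assoc m_closed)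
  show "x \<otimes> y \<in> {x \<in> carrier G. x \<otimes> c = c \<otimes> x}"
    using xy assms by (simp add: m_assoc) (simp flip: m_assoc)
qed (use assms in auto)

text \<open>If \<open>[y, c]\<close> and \<open>[x, c]\<close> are central and equal, then they cancel in the commutator of
  \<open>y x\<^sup>-\<^sup>1\<close> with \<open>c\<close>. The equality arises here from \<open>[x, c] = [y, d c]\<close>, since a factor \<open>d\<close> that commutes
  with \<open>y\<close> does not change a central commutator.\<close>

lemma quotient_commutes_of_equal_commutators:
  assumes car: "x \<in> carrier G" "y \<in> carrier G" "c \<in> carrier G" "d \<in> carrier G"
    and dy: "y \<otimes> d = d \<otimes> y"
    and eq: "group_commutator G y (d \<otimes> c) = group_commutator G x c"
    and cx: "\<And>g. g \<in> carrier G \<Longrightarrow> g \<otimes> group_commutator G x c = group_commutator G x c \<otimes> g"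
    and cy: "\<And>g. g \<in> carrier G \<Longrightarrow> g \<otimes> group_commutator G y c = group_commutator G y c \<otimes> g"
  shows "(y \<otimes> inv x) \<otimes> c = c \<otimes> (y \<otimes> inv x)"
proof -
  define z where "z = group_commutator G x c"
  define w where "w = group_commutator G y c"
  have [simp]: "z \<in> carrier G" "w \<in> carrier G" using car by (auto simp: z_def w_def)
  have xc: "x \<otimes> c = z \<otimes> (c \<otimes> x)" and yc: "y \<otimes> c = w \<otimes> (c \<otimes> y)"
    using car by (simp_all add: z_def w_def group_commutator_mult_swap)
  have "y \<otimes> (d \<otimes> c) = d \<otimes> (y \<otimes> c)" using car dy by (simp flip: m_assoc)
  also have "\<dots> = (d \<otimes> w) \<otimes> (c \<otimes> y)" using car by (simp add: yc m_assoc)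
  also have "\<dots> = w \<otimes> ((d \<otimes> c) \<otimes> y)" using car cy[of d] by (simp add: w_def[symmetric] m_assoc)
  finally have "group_commutator G y (d \<otimes> c) = w"
    using car by (intro group_commutator_eqI) auto
  then have wz: "w = z" using eq by (simp add: z_def)
  have "x \<otimes> (c \<otimes> inv x) = z \<otimes> c"
    using car xc by (simp add: m_assoc flip: m_assoc[of x c])
  then have "c \<otimes> inv x = inv x \<otimes> (z \<otimes> c)"
    using car by (metis inv_closed inv_solve_left m_closed \<open>z \<in> carrier G\<close>)
  also have "\<dots> = z \<otimes> (inv x \<otimes> c)"
    using car cx[of "inv x"] by (simp add: z_def[symmetric] flip: m_assoc)
  finally have cix: "c \<otimes> inv x = z \<otimes> (inv x \<otimes> c)" .
  have "z \<otimes> ((y \<otimes> inv x) \<otimes> c) = y \<otimes> (z \<otimes> (inv x \<otimes> c))"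
    using car cx[of y] by (simp add: z_def[symmetric] flip: m_assoc)
  also have "\<dots> = (y \<otimes> c) \<otimes> inv x" using car by (simp add: m_assoc flip: cix)
  also have "\<dots> = z \<otimes> (c \<otimes> (y \<otimes> inv x))" using car by (simp add: yc wz m_assoc)
  finally show ?thesis using car by simp
qed

end

lemma hom_group_commutator:
  fixes G :: "'a monoid" and H :: "'b monoid"
  assumes "group_hom G H h" "x \<in> carrier G" "y \<in> carrier G"
  shows "h (group_commutator G x y) = group_commutator H (h x) (h y)"
proof -
  interpret group_hom G H h by fact
  show ?thesis using assms(2,3) by (simp add: group_commutator_def)
qed

context
  fixes G :: "'a monoid" (structure) and H :: "'a set"
  assumes H: "H \<lhd> G"
  \<comment> \<open>Products and the unit of \<open>G Mod H\<close> stay abstract, so that the group laws apply to them instead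
    of set operations on cosets.\<close>
  notes [simp del] = mult_FactGroup one_FactGroup
begin

interpretation normal H G by (rule H)

interpretation \<pi>: group_hom G "G Mod H" "\<lambda>x. H #> x"
  by (rule group_hom.intro)
    (auto simp: group_hom_axioms_def factorgroup_is_group r_coset_hom_Mod is_group)

text \<open>The dictionary between the membership of a commutator in a normal subgroup and commutation in
  the quotient, where the centrality arguments take place.\<close>

lemma commute_mod_iff:
  assumes "x \<in> carrier G" "y \<in> carrier G"
  shows "(H #> x) \<otimes>\<^bsub>G Mod H\<^esub> (H #> y) = (H #> y) \<otimes>\<^bsub>G Mod H\<^esub> (H #> x)
    \<longleftrightarrow> group_commutator G x y \<in> H"
proof -
  have "group_commutator G x y \<in> H \<longleftrightarrow> H #> group_commutator G x y = \<one>\<^bsub>G Mod H\<^esub>"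
    using assms by (metis coset_join1 coset_join2 group_commutator_closed[OF is_group] is_subgroup one_FactGroup subset)
  then show ?thesis
    using assms by (simp add: hom_group_commutator[OF \<pi>.group_hom_axioms] group_commutator_eq_one_iff[OF factorgroup_is_group])
qed

text \<open>The inductive step of the three subgroups argument for one endomorphism \<open>\<phi>\<close>. Modulo \<open>H\<close> it is
  \<open>quotient_commutes_of_equal_commutators\<close> with \<open>x = b\<close>, \<open>y = \<phi>(b)\<close> and \<open>d = \<phi>(c) c\<^sup>-\<^sup>1\<close>: since \<open>\<phi>\<close> fixes \<open>[b, c]\<close> modulo
  \<open>H\<close>, this commutator agrees with \<open>[\<phi>(b), \<phi>(c)] = [\<phi>(b), d c]\<close>.\<close>

lemma commutator_displacement_in:
  assumes \<phi>: "\<phi> \<in> hom G G" and car: "b \<in> carrier G" "c \<in> carrier G"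
    and fixed: "\<phi> (group_commutator G b c) \<otimes> inv (group_commutator G b c) \<in> H"
    and dy: "group_commutator G (\<phi> b) (\<phi> c \<otimes> inv c) \<in> H"
    and cb: "\<And>g. g \<in> carrier G \<Longrightarrow> group_commutator G g (group_commutator G b c) \<in> H"
    and cy: "\<And>g. g \<in> carrier G \<Longrightarrow> group_commutator G g (group_commutator G (\<phi> b) c) \<in> H"
  shows "group_commutator G (\<phi> b \<otimes> inv b) c \<in> H"
proof -
  interpret \<phi>: group_hom G G \<phi>
    by (rule group_hom.intro) (auto simp: group_hom_axioms_def \<phi> is_group)
  let ?Q = "G Mod H" and ?p = "\<lambda>x. H #> x"
  have surj: "\<exists>g\<in>carrier G. q = ?p g" if "q \<in> carrier ?Q" for q
    using that by (auto simp: FactGroup_def RCOSETS_def)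
  have "?p (\<phi> (group_commutator G b c)) = ?p (group_commutator G b c)"
    using car fixed by (metis group_commutator_closed[OF is_group] \<phi>.hom_closed repr_independence rcos_module_rev is_group is_subgroup)
  then have "group_commutator ?Q (?p (\<phi> b)) (?p (\<phi> c)) = group_commutator ?Q (?p b) (?p c)"
    using car by (simp add: hom_group_commutator[OF \<phi>.group_hom_axioms] hom_group_commutator[OF \<pi>.group_hom_axioms])
  moreover have "\<phi> c = (\<phi> c \<otimes> inv c) \<otimes> c" using car by (simp add: m_assoc)
  ultimately have eq: "group_commutator ?Q (?p (\<phi> b)) (?p (\<phi> c \<otimes> inv c) \<otimes>\<^bsub>?Q\<^esub> ?p c)
      = group_commutator ?Q (?p b) (?p c)"
    using car by (metis \<phi>.hom_closed \<pi>.hom_mult inv_closed m_closed)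
  have "(?p (\<phi> b) \<otimes>\<^bsub>?Q\<^esub> inv\<^bsub>?Q\<^esub> ?p b) \<otimes>\<^bsub>?Q\<^esub> ?p c = ?p c \<otimes>\<^bsub>?Q\<^esub> (?p (\<phi> b) \<otimes>\<^bsub>?Q\<^esub> inv\<^bsub>?Q\<^esub> ?p b)"
  proof (rule quotient_commutes_of_equal_commutators[OF factorgroup_is_group _ _ _ _ _ eq])
    show "?p (\<phi> b) \<otimes>\<^bsub>?Q\<^esub> ?p (\<phi> c \<otimes> inv c) = ?p (\<phi> c \<otimes> inv c) \<otimes>\<^bsub>?Q\<^esub> ?p (\<phi> b)"
      using car dy by (subst commute_mod_iff) auto
  next
    fix q assume "q \<in> carrier ?Q"
    then obtain g where g: "g \<in> carrier G" "q = ?p g" using surj by blast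
    show "q \<otimes>\<^bsub>?Q\<^esub> group_commutator ?Q (?p b) (?p c) = group_commutator ?Q (?p b) (?p c) \<otimes>\<^bsub>?Q\<^esub> q"
      using car g cb[of g] commute_mod_iff[of g "group_commutator G b c"]
      by (simp add: hom_group_commutator[OF \<pi>.group_hom_axioms])
    show "q \<otimes>\<^bsub>?Q\<^esub> group_commutator ?Q (?p (\<phi> b)) (?p c) = group_commutator ?Q (?p (\<phi> b)) (?p c) \<otimes>\<^bsub>?Q\<^esub> q"
      using car g cy[of g] commute_mod_iff[of g "group_commutator G (\<phi> b) c"]
      by (simp add: hom_group_commutator[OF \<pi>.group_hom_axioms])
  qed (use car in auto)
  then show ?thesis
    using car commute_mod_iff[of "\<phi> b \<otimes> inv b" c] by simp
qed

text \<open>The preimage of a centralizer in the quotient is a subgroup, so a commutator condition modulo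
  \<open>H\<close> may be checked on generators.\<close>

lemma commutator_generate_in:
  assumes S: "S \<subseteq> carrier G" and c: "c \<in> carrier G"
    and gens: "\<And>s. s \<in> S \<Longrightarrow> group_commutator G s c \<in> H"
    and x: "x \<in> generate G S"
  shows "group_commutator G x c \<in> H"
proof -
  let ?Z = "{q \<in> carrier (G Mod H). q \<otimes>\<^bsub>G Mod H\<^esub> (H #> c) = (H #> c) \<otimes>\<^bsub>G Mod H\<^esub> q}"
  have "generate (G Mod H) ((\<lambda>x. H #> x) ` S) \<subseteq> ?Z"
    using c S gens
    by (intro \<pi>.H.generate_subgroup_incl commuting_subgroup[OF factorgroup_is_group] image_subsetI)
      (simp_all add: commute_mod_iff subset_iff)
  then have "H #> x \<in> ?Z"
    using x S \<pi>.generate_img[of S] by blast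
  then show ?thesis
    using x c S generate_in_carrier[OF S x] commute_mod_iff[of x c] by simp
qed

end

section \<open>The left series of a skew brace\<close>

context skew_brace
begin

lemma brace_lambda_closed:
  assumes "a \<in> carrier M" "b \<in> carrier M"
  shows "brace_lambda M C a b \<in> carrier M"
  using assms C.m_closed[of a b] by (simp add: brace_lambda_def same_carrier)

lemma brace_lambda_hom:
  assumes "a \<in> carrier M"
  shows "brace_lambda M C a \<in> hom M M"
proof (rule homI)
  fix b c assume "b \<in> carrier M" "c \<in> carrier M"
  then show "brace_lambda M C a (b \<otimes> c) = brace_lambda M C a b \<otimes> brace_lambda M C a c"
    using assms C.m_closed[of a b] C.m_closed[of a c]
    by (simp add: brace_lambda_def compat same_carrier M.m_assoc)
qed (use assms brace_lambda_closed in auto)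

text \<open>Collecting both kinds of maps in one set lets every argument about the series treat the
  generators \<open>a * b\<close> and \<open>[a, b]\<close> together.\<close>

definition inner_and_lambda_maps :: "('a \<Rightarrow> 'a) set" where
  "inner_and_lambda_maps =
     {brace_lambda M C a | a. a \<in> carrier M} \<union> {\<lambda>b. a \<otimes> b \<otimes> inv a | a. a \<in> carrier M}"

lemma brace_lambda_in_maps: "a \<in> carrier M \<Longrightarrow> brace_lambda M C a \<in> inner_and_lambda_maps"
  by (auto simp: inner_and_lambda_maps_def)

lemma conjugation_in_maps: "a \<in> carrier M \<Longrightarrow> (\<lambda>b. a \<otimes> b \<otimes> inv a) \<in> inner_and_lambda_maps"
  by (auto simp: inner_and_lambda_maps_def)

lemma inner_and_lambda_maps_hom:
  assumes "\<phi> \<in> inner_and_lambda_maps"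
  shows "\<phi> \<in> hom M M"
proof -
  have "(\<lambda>b. a \<otimes> b \<otimes> inv a) \<in> hom M M" if "a \<in> carrier M" for a
    using that by (intro homI) (auto simp: M.m_assoc M.inv_solve_left' simp flip: M.m_assoc[of "inv a" a])
  then show ?thesis
    using assms brace_lambda_hom by (auto simp: inner_and_lambda_maps_def)
qed

lemma L_series_Suc_Suc_eq:
  "L_series M C (Suc (Suc i)) =
     generate M {\<phi> b \<otimes> inv b | \<phi> b. \<phi> \<in> inner_and_lambda_maps \<and> b \<in> L_series M C (Suc i)}"
proof -
  let ?L = "L_series M C (Suc i)"
  let ?D = "{\<phi> b \<otimes> inv b | \<phi> b. \<phi> \<in> inner_and_lambda_maps \<and> b \<in> ?L}"
  have star: "brace_star M C a b = brace_lambda M C a b \<otimes> inv b" for a b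
    by (simp add: brace_star_def brace_lambda_def)
  have comm: "group_commutator M a b = (\<lambda>b. a \<otimes> b \<otimes> inv a) b \<otimes> inv b" for a b
    by (simp add: group_commutator_def)
  have displacement: "\<phi> b \<otimes> inv b \<in> ?D" if "\<phi> \<in> inner_and_lambda_maps" "b \<in> ?L" for \<phi> b
    using that by blast
  have "brace_star M C a b \<in> ?D" "group_commutator M a b \<in> ?D"
    if ab: "a \<in> carrier M" "b \<in> ?L" for a b
  proof -
    show "brace_star M C a b \<in> ?D"
      unfolding star by (rule displacement[OF brace_lambda_in_maps[OF ab(1)] ab(2)])
    show "group_commutator M a b \<in> ?D"
      unfolding comm by (rule displacement[OF conjugation_in_maps[OF ab(1)] ab(2)])
  qed
  moreover have "?D \<subseteq> {brace_star M C a b | a b. a \<in> carrier M \<and> b \<in> ?L} \<union>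
     {group_commutator M a b | a b. a \<in> carrier M \<and> b \<in> ?L}"
    by (auto simp: inner_and_lambda_maps_def star group_commutator_def)
  ultimately have "?D = {brace_star M C a b | a b. a \<in> carrier M \<and> b \<in> ?L} \<union>
     {group_commutator M a b | a b. a \<in> carrier M \<and> b \<in> ?L}"
    by blast
  then show ?thesis by simp
qed

lemma L_series_subgroup: "subgroup (L_series M C (Suc i)) M"
proof (induction i)
  case 0
  then show ?case by (simp add: M.subgroup_self)
next
  case (Suc i)
  then have "L_series M C (Suc i) \<subseteq> carrier M" by (rule subgroup.subset)
  then show ?case
    unfolding L_series_Suc_Suc_eq
    using inner_and_lambda_maps_hom by (intro M.generate_is_subgroup) (fastforce simp: hom_def)
qed

lemma L_series_carrier: "b \<in> L_series M C (Suc i) \<Longrightarrow> b \<in> carrier M"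
  using L_series_subgroup subgroup.subset by blast

lemma L_series_displacement:
  assumes "\<phi> \<in> inner_and_lambda_maps" "b \<in> L_series M C (Suc i)"
  shows "\<phi> b \<otimes> inv b \<in> L_series M C (Suc (Suc i))"
  unfolding L_series_Suc_Suc_eq using assms by (intro generate.incl) blast

lemma L_series_antimono_Suc: "L_series M C (Suc (Suc i)) \<subseteq> L_series M C (Suc i)"
proof (induction i)
  case 0
  show ?case using subgroup.subset[OF L_series_subgroup[of "Suc 0"]] by simp
next
  case (Suc i)
  then show ?case
    unfolding L_series_Suc_Suc_eq[of "Suc i"] L_series_Suc_Suc_eq[of i]
    by (intro M.mono_generate) blast
qed

text \<open>Normality and invariance under all \<open>\<lambda>\<^sub>a\<close> in one: moving \<open>b\<close> by \<open>\<phi>\<close> multiplies it by a displacement,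
  which lies in the next term of the series and so in the same one.\<close>

lemma L_series_invariant:
  assumes \<phi>: "\<phi> \<in> inner_and_lambda_maps" and b: "b \<in> L_series M C (Suc i)"
  shows "\<phi> b \<in> L_series M C (Suc i)"
proof -
  have "\<phi> b \<otimes> inv b \<otimes> b \<in> L_series M C (Suc i)"
    using L_series_displacement[OF \<phi> b] L_series_antimono_Suc b L_series_subgroup
    by (blast intro: subgroup.m_closed)
  moreover have "\<phi> b \<in> carrier M"
    using inner_and_lambda_maps_hom[OF \<phi>] L_series_carrier[OF b] by (auto simp: hom_def)
  ultimately show ?thesis
    using L_series_carrier[OF b] by (simp add: M.m_assoc)
qed

lemma L_series_normal: "L_series M C (Suc i) \<lhd> M"
  using L_series_invariant[OF conjugation_in_maps] L_series_subgroup
  by (simp add: M.normal_inv_iff)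

lemma L_series_strong_left_ideal: "strong_left_ideal M C (L_series M C (Suc i))"
  using L_series_normal L_series_invariant[OF brace_lambda_in_maps]
  by (simp add: strong_left_ideal_def)

lemma L_series_commutator_whole:
  assumes "a \<in> carrier M" "b \<in> L_series M C (Suc i)"
  shows "group_commutator M a b \<in> L_series M C (Suc (Suc i))"
  using assms by (auto intro: generate.incl)

text \<open>The index \<open>j\<close> must stay arbitrary in the induction on \<open>i\<close>: the step uses the hypothesis both for
  \<open>c\<close> in \<open>L\<^sup>j\<close> and for \<open>\<phi>(c) c\<^sup>-\<^sup>1\<close> in \<open>L\<^sup>j\<^sup>+\<^sup>1\<close>.\<close>

lemma L_series_commutator:
  assumes "b \<in> L_series M C (Suc i)" "c \<in> L_series M C (Suc j)"
  shows "group_commutator M b c \<in> L_series M C (Suc i + Suc j)"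
  using assms
proof (induction i arbitrary: j b c)
  case 0
  then show ?case using L_series_commutator_whole[of b c j] by simp
next
  case (Suc i)
  let ?N = "L_series M C (Suc (Suc i) + Suc j)"
  have N: "?N \<lhd> M" using L_series_normal[of "Suc i + Suc j"] by simp
  have IH: "group_commutator M b c \<in> L_series M C (Suc (Suc (i + j)))"
    if "b \<in> L_series M C (Suc i)" "c \<in> L_series M C (Suc j)" for b c j
    using Suc.IH[OF that] by simp
  let ?S = "{\<phi> b \<otimes> inv b | \<phi> b. \<phi> \<in> inner_and_lambda_maps \<and> b \<in> L_series M C (Suc i)}"
  have gens: "group_commutator M s c \<in> ?N" if sS: "s \<in> ?S" for s
  proof -
    obtain \<phi> b where s: "s = \<phi> b \<otimes> inv b" and \<phi>: "\<phi> \<in> inner_and_lambda_maps"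
      and b: "b \<in> L_series M C (Suc i)" using sS by auto
    have \<phi>b: "\<phi> b \<in> L_series M C (Suc i)" by (rule L_series_invariant[OF \<phi> b])
    show ?thesis
      unfolding s
    proof (rule commutator_displacement_in[OF N inner_and_lambda_maps_hom[OF \<phi>]])
      show "\<phi> (group_commutator M b c) \<otimes> inv (group_commutator M b c) \<in> ?N"
        using L_series_displacement[OF \<phi> IH[OF b Suc.prems(2)]] by (simp del: L_series.simps)
      show "group_commutator M (\<phi> b) (\<phi> c \<otimes> inv c) \<in> ?N"
        using IH[OF \<phi>b L_series_displacement[OF \<phi> Suc.prems(2)]] by (simp del: L_series.simps)
      show "group_commutator M g (group_commutator M b c) \<in> ?N" if "g \<in> carrier M" for g
        using L_series_commutator_whole[OF that IH[OF b Suc.prems(2)]] by (simp del: L_series.simps)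
      show "group_commutator M g (group_commutator M (\<phi> b) c) \<in> ?N" if "g \<in> carrier M" for g
        using L_series_commutator_whole[OF that IH[OF \<phi>b Suc.prems(2)]] by (simp del: L_series.simps)
    qed (use b Suc.prems L_series_carrier in blast)+
  qed
  have "?S \<subseteq> carrier M"
    using L_series_carrier L_series_displacement by blast
  then show ?case
    using commutator_generate_in[OF N _ _ gens] Suc.prems L_series_carrier
    unfolding L_series_Suc_Suc_eq[of i] by blast
qed

end

theorem lemma4p9:
  fixes M C :: "'a monoid"
  assumes "skew_brace M C"
  shows "filtered_skew_brace M C (\<lambda>i. if i = 0 then carrier M else L_series M C i)"
proof -
  interpret skew_brace M C by fact
  define F where "F = (\<lambda>i. if i = 0 then carrier M else L_series M C i)"
  \<comment> \<open>The terms 0 and 1 of the filtration are both the whole group, so every term is one of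
    the \<open>L\<^sup>i\<close> with \<open>i \<ge> 1\<close>.\<close>
  have F0: "F 0 = L_series M C (Suc 0)" and FS: "F (Suc i) = L_series M C (Suc i)" for i
    by (auto simp: F_def)
  have ideal: "strong_left_ideal M C (F i)" for i
    using L_series_strong_left_ideal by (cases i) (simp_all only: F0 FS)
  have "group_commutator M h k \<in> F (i + j)" if h: "h \<in> F i" and k: "k \<in> F j" for h k i j
  proof (cases "i = 0")
    \<comment> \<open>An index 0 adds nothing to the sum, so normality of the other term suffices; for the first
      argument it comes from \<open>[A, L\<^sup>j] \<subseteq> L\<^sup>j\<^sup>+\<^sup>1 \<subseteq> L\<^sup>j\<close>.\<close>
    case True
    then have hA: "h \<in> carrier M" using h by (simp add: F_def)
    show ?thesis
    proof (cases j)
      case 0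
      then show ?thesis using hA k True by (simp add: F_def group_commutator_closed[OF M.is_group])
    next
      case (Suc j')
      then have "group_commutator M h k \<in> L_series M C (Suc (Suc j'))"
        using L_series_commutator_whole[OF hA] k by (simp only: FS)
      then show ?thesis
        using True Suc L_series_antimono_Suc[of j'] by (simp only: FS add_0) blast
    qed
  next
    case i: False
    show ?thesis
    proof (cases "j = 0")
      case True
      have sub: "subgroup (F i) M" and nrm: "F i \<lhd> M"
        using ideal[of i] by (simp_all add: strong_left_ideal_def M.normal_inv_iff)
      have hk: "h \<in> carrier M" "k \<in> carrier M"
        using h k True subgroup.mem_carrier[OF sub] by (auto simp: F_def)
      then have "k \<otimes>\<^bsub>M\<^esub> inv\<^bsub>M\<^esub> h \<otimes>\<^bsub>M\<^esub> inv\<^bsub>M\<^esub> k \<in> F i"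
        using nrm subgroup.m_inv_closed[OF sub h] by (simp add: M.normal_inv_iff)
      from subgroup.m_closed[OF sub h this]
      show ?thesis using True hk by (simp add: group_commutator_def M.m_assoc)
    next
      case False
      then obtain i' j' where "i = Suc i'" "j = Suc j'" using i by (cases i; cases j) auto
      then show ?thesis
        using h k L_series_commutator[of h i' k j'] by (simp add: FS del: L_series.simps)
    qed
  qed
  moreover have "subgroup (F i) M" for i
    using ideal[of i] by (simp add: strong_left_ideal_def M.normal_inv_iff)
  ultimately have comm: "commutator_subgroup M (F i) (F j) \<subseteq> F (i + j)" for i j
    unfolding commutator_subgroup_def by (intro M.generate_subgroup_incl) auto
  have "filtered_skew_brace M C F"
  proof
    show "F 0 = carrier M" by (simp add: F_def)
    show "F (Suc i) \<subseteq> F i" for i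
      using L_series_antimono_Suc by (cases i) (auto simp: F0 FS simp del: L_series.simps(3))
  qed (fact ideal comm)+
  then show ?thesis by (simp add: F_def)
qed

end
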